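(* Let $T$ be a recursively enumerable extension of Robinson's arithmetic $\mathbf{Q}$. If $T$ is consistent, then every Rosserian $\Pi_1$-sentence of $T$ is true, and every Rosserian $\Sigma_1$-sentence of $T$ is false.
   Context: All theories and sentences are in the language of first-order arithmetic; "true" and "false" mean true and false in the standard model $\mathbb{N}$. A fixed Gödel numbering of the syntax is given; $\#A$ denotes the numeral of the Gödel code of the expression $A$, and $\overline{m}$ the numeral of $m\in\mathbb{N}$. $\mathrm{prf}_T(y,x)$ is a fixed proof predicate of $T$: a $\Delta_1$-formula (i.e. $\mathbf{Q}$-provably equivalent both to a $\Sigma_1$-formula and to a $\Pi_1$-formula) stating that "$y$ is the code of a proof in $T$ of the formula coded by $x$", which satisfies, for every sentence $\varphi$: $T\vdash\varphi$ iff $\mathbf{Q}\vdash\mathrm{prf}_T(\overline{m},\#\varphi)$ for some $m\in\mathbb{N}$; and $T\nvdash\varphi$ iff $\mathbf{Q}\vdash\neg\mathrm{prf}_T(\overline{n},\#\varphi)$ for every $n\in\mathbb{N}$. The Rosserian provability predicate of $T$ is the $\Sigma_1$-formula $\mathrm{R.Pr}_T(x)=\exists y\,[\mathrm{prf}_T(y,x)\wedge\forall z<y\,\neg\mathrm{prf}_T(z,\neg x)]$, where $\neg x$ inside $\mathrm{prf}_T$ stands for the code of the negation of the formula coded by $x$ (so that $\mathrm{R.Pr}_T(\#\varphi)$ is $\exists y[\mathrm{prf}_T(y,\#\varphi)\wedge\forall z<y\,\neg\mathrm{prf}_T(z,\#[\neg\varphi])]$). A sentence $\rho$ is a Rosserian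 sentence of $T$ when $T\vdash\rho\leftrightarrow\neg\mathrm{R.Pr}_T(\#\rho)$; a Rosserian $\Gamma$-sentence is a Rosserian sentence belonging to the class $\Gamma$. *)

theory Defs
  imports Main "HOL-Library.Nat_Bijection"
begin

section \<open>Syntax of first-order arithmetic\<close>

text \<open>Variables are de Bruijn indices: in \<open>Forall p\<close> the index 0 of \<open>p\<close> is bound, and the
  index \<open>Suc n\<close> of \<open>p\<close> is the index \<open>n\<close> outside.\<close>

datatype tm = Var nat | Zero | Succ tm | Plus tm tm | Times tm tm

datatype fm = Eq tm tm | Neg fm | Imp fm fm | Forall fm

primrec tfv :: "tm \<Rightarrow> nat set" where
  "tfv (Var n) = {n}"
| "tfv Zero = {}"
| "tfv (Succ t) = tfv t"
| "tfv (Plus s t) = tfv s \<union> tfv t"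
| "tfv (Times s t) = tfv s \<union> tfv t"

primrec fv :: "fm \<Rightarrow> nat set" where
  "fv (Eq s t) = tfv s \<union> tfv t"
| "fv (Neg p) = fv p"
| "fv (Imp p q) = fv p \<union> fv q"
| "fv (Forall p) = {n. Suc n \<in> fv p}"

definition sentence :: "fm \<Rightarrow> bool" where
  "sentence p \<longleftrightarrow> fv p = {}"

primrec tsubst :: "(nat \<Rightarrow> tm) \<Rightarrow> tm \<Rightarrow> tm" where
  "tsubst \<sigma> (Var n) = \<sigma> n"
| "tsubst \<sigma> Zero = Zero"
| "tsubst \<sigma> (Succ t) = Succ (tsubst \<sigma> t)"
| "tsubst \<sigma> (Plus s t) = Plus (tsubst \<sigma> s) (tsubst \<sigma> t)"
| "tsubst \<sigma> (Times s t) = Times (tsubst \<sigma> s) (tsubst \<sigma> t)"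

definition tlift :: "tm \<Rightarrow> tm" where
  "tlift t = tsubst (\<lambda>n. Var (Suc n)) t"

primrec subst :: "(nat \<Rightarrow> tm) \<Rightarrow> fm \<Rightarrow> fm" where
  "subst \<sigma> (Eq s t) = Eq (tsubst \<sigma> s) (tsubst \<sigma> t)"
| "subst \<sigma> (Neg p) = Neg (subst \<sigma> p)"
| "subst \<sigma> (Imp p q) = Imp (subst \<sigma> p) (subst \<sigma> q)"
| "subst \<sigma> (Forall p) = Forall (subst (case_nat (Var 0) (\<lambda>n. tlift (\<sigma> n))) p)"

definition lift :: "fm \<Rightarrow> fm" where
  "lift p = subst (\<lambda>n. Var (Suc n)) p"

text \<open>\<open>inst p t\<close> is the instance by \<open>t\<close> of the quantified formula \<open>Forall p\<close>.\<close>

definition inst :: "fm \<Rightarrow> tm \<Rightarrow> fm" where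
  "inst p t = subst (case_nat t Var) p"

text \<open>A formula \<open>p(y, x)\<close> in two free variables has \<open>y\<close> as index 0 and \<open>x\<close> as index 1;
  \<open>inst2 p s t\<close> is \<open>p(s, t)\<close>.\<close>

definition inst2 :: "fm \<Rightarrow> tm \<Rightarrow> tm \<Rightarrow> fm" where
  "inst2 p s t = subst (case_nat s (case_nat t Var)) p"

definition Conj :: "fm \<Rightarrow> fm \<Rightarrow> fm" where
  "Conj p q = Neg (Imp p (Neg q))"

definition Iff :: "fm \<Rightarrow> fm \<Rightarrow> fm" where
  "Iff p q = Conj (Imp p q) (Imp q p)"

definition Exists :: "fm \<Rightarrow> fm" where
  "Exists p = Neg (Forall (Neg p))"

text \<open>\<open>s < t\<close> abbreviates \<open>\<exists>z. z + S s = t\<close>. The order of the summands matters, because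
  Robinson's arithmetic does not prove that addition is commutative.\<close>

definition Less :: "tm \<Rightarrow> tm \<Rightarrow> fm" where
  "Less s t = Exists (Eq (Plus (Var 0) (Succ (tlift s))) (tlift t))"

text \<open>The bound \<open>t\<close> lives outside the quantifier, so it cannot contain the quantified variable.\<close>

definition BAll :: "tm \<Rightarrow> fm \<Rightarrow> fm" where
  "BAll t p = Forall (Imp (Less (Var 0) (tlift t)) p)"

definition BEx :: "tm \<Rightarrow> fm \<Rightarrow> fm" where
  "BEx t p = Exists (Conj (Less (Var 0) (tlift t)) p)"

primrec num :: "nat \<Rightarrow> tm" where
  "num 0 = Zero"
| "num (Suc n) = Succ (num n)"


section \<open>Truth in the standard model\<close>

primrec val :: "(nat \<Rightarrow> nat) \<Rightarrow> tm \<Rightarrow> nat" where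
  "val e (Var n) = e n"
| "val e Zero = 0"
| "val e (Succ t) = Suc (val e t)"
| "val e (Plus s t) = val e s + val e t"
| "val e (Times s t) = val e s * val e t"

primrec sat :: "(nat \<Rightarrow> nat) \<Rightarrow> fm \<Rightarrow> bool" where
  "sat e (Eq s t) \<longleftrightarrow> val e s = val e t"
| "sat e (Neg p) \<longleftrightarrow> \<not> sat e p"
| "sat e (Imp p q) \<longleftrightarrow> (sat e p \<longrightarrow> sat e q)"
| "sat e (Forall p) \<longleftrightarrow> (\<forall>x. sat (case_nat x e) p)"

text \<open>Only used for sentences, whose truth value does not depend on the assignment.\<close>

definition true_in_N :: "fm \<Rightarrow> bool" where
  "true_in_N p \<longleftrightarrow> sat (\<lambda>_. 0) p"


section \<open>Arithmetical hierarchy\<close>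

text \<open>Atoms \<open>s < t\<close> count as quantifier-free although \<open><\<close> is a defined symbol. The classes
  of \<open>\<Sigma>\<^sub>1\<close>- and \<open>\<Pi>\<^sub>1\<close>-formulas are closed under conjunction, disjunction and
  bounded quantification, and in particular contain every formula that consists of a block of
  existential, respectively universal, quantifiers in front of a \<open>\<Delta>\<^sub>0\<close>-formula.\<close>

inductive delta0 :: "fm \<Rightarrow> bool" where
  "delta0 (Eq s t)"
| "delta0 (Less s t)"
| "delta0 p \<Longrightarrow> delta0 (Neg p)"
| "delta0 p \<Longrightarrow> delta0 q \<Longrightarrow> delta0 (Imp p q)"
| "delta0 p \<Longrightarrow> delta0 (BAll t p)"
| "delta0 p \<Longrightarrow> delta0 (BEx t p)"

inductive sigma1 :: "fm \<Rightarrow> bool" and pi1 :: "fm \<Rightarrow> bool" where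
  "delta0 p \<Longrightarrow> sigma1 p"
| "pi1 p \<Longrightarrow> sigma1 (Neg p)"
| "pi1 p \<Longrightarrow> sigma1 q \<Longrightarrow> sigma1 (Imp p q)"
| "sigma1 p \<Longrightarrow> sigma1 (BAll t p)"
| "sigma1 p \<Longrightarrow> sigma1 (Exists p)"
| "delta0 p \<Longrightarrow> pi1 p"
| "sigma1 p \<Longrightarrow> pi1 (Neg p)"
| "sigma1 p \<Longrightarrow> pi1 q \<Longrightarrow> pi1 (Imp p q)"
| "pi1 p \<Longrightarrow> pi1 (BEx t p)"
| "pi1 p \<Longrightarrow> pi1 (Forall p)"


section \<open>Proofs, theories and Robinson's arithmetic\<close>

inductive logical_axiom :: "fm \<Rightarrow> bool" where
  "logical_axiom (Imp p (Imp q p))"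
| "logical_axiom (Imp (Imp p (Imp q r)) (Imp (Imp p q) (Imp p r)))"
| "logical_axiom (Imp (Imp (Neg p) (Neg q)) (Imp q p))"
| "logical_axiom (Imp (Forall p) (inst p t))"
| "logical_axiom (Imp (Forall (Imp p q)) (Imp (Forall p) (Forall q)))"
| "logical_axiom (Imp p (Forall (lift p)))"
| "logical_axiom (Eq t t)"
| "logical_axiom (Imp (Eq s t) (Imp (inst p s) (inst p t)))"

text \<open>Each entry of a derivation is a logical axiom, an axiom of \<open>T\<close>, or obtained from
  earlier entries by modus ponens or generalization.\<close>

definition derivation :: "fm set \<Rightarrow> fm list \<Rightarrow> bool" where
  "derivation T d \<longleftrightarrow> (\<forall>i < length d.
      logical_axiom (d ! i) \<or> d ! i \<in> T \<or>
      (\<exists>j < i. \<exists>k < i. d ! k = Imp (d ! j) (d ! i)) \<or>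
      (\<exists>j < i. d ! i = Forall (d ! j)))"

definition proof_of :: "fm set \<Rightarrow> fm list \<Rightarrow> fm \<Rightarrow> bool" where
  "proof_of T d p \<longleftrightarrow> derivation T d \<and> d \<noteq> [] \<and> last d = p"

definition provable :: "fm set \<Rightarrow> fm \<Rightarrow> bool"  (infix "\<turnstile>" 50) where
  "T \<turnstile> p \<longleftrightarrow> (\<exists>d. proof_of T d p)"

definition is_theory :: "fm set \<Rightarrow> bool" where
  "is_theory T \<longleftrightarrow> (\<forall>p \<in> T. sentence p)"

definition consistent :: "fm set \<Rightarrow> bool" where
  "consistent T \<longleftrightarrow> \<not> (\<exists>p. T \<turnstile> p \<and> T \<turnstile> Neg p)"

definition extends :: "fm set \<Rightarrow> fm set \<Rightarrow> bool" where
  "extends T U \<longleftrightarrow> (\<forall>p. U \<turnstile> p \<longrightarrow> T \<turnstile> p)"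

definition robinson_Q :: "fm set" where
  "robinson_Q =
    {Forall (Neg (Eq (Succ (Var 0)) Zero)),
     Forall (Forall (Imp (Eq (Succ (Var 1)) (Succ (Var 0))) (Eq (Var 1) (Var 0)))),
     Forall (Imp (Neg (Eq (Var 0) Zero)) (Exists (Eq (Var 1) (Succ (Var 0))))),
     Forall (Eq (Plus (Var 0) Zero) (Var 0)),
     Forall (Forall (Eq (Plus (Var 1) (Succ (Var 0))) (Succ (Plus (Var 1) (Var 0))))),
     Forall (Eq (Times (Var 0) Zero) Zero),
     Forall (Forall (Eq (Times (Var 1) (Succ (Var 0))) (Plus (Times (Var 1) (Var 0)) (Var 1))))}"

definition delta1 :: "fm \<Rightarrow> bool" where
  "delta1 p \<longleftrightarrow> (\<exists>s. sigma1 s \<and> robinson_Q \<turnstile> Iff p s) \<and> (\<exists>q. pi1 q \<and> robinson_Q \<turnstile> Iff p q)"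


section \<open>Goedel numbering and recursive enumerability\<close>

primrec tcode :: "tm \<Rightarrow> nat" where
  "tcode (Var n) = prod_encode (0, n)"
| "tcode Zero = prod_encode (1, 0)"
| "tcode (Succ t) = prod_encode (2, tcode t)"
| "tcode (Plus s t) = prod_encode (3, prod_encode (tcode s, tcode t))"
| "tcode (Times s t) = prod_encode (4, prod_encode (tcode s, tcode t))"

primrec code :: "fm \<Rightarrow> nat" where
  "code (Eq s t) = prod_encode (0, prod_encode (tcode s, tcode t))"
| "code (Neg p) = prod_encode (1, code p)"
| "code (Imp p q) = prod_encode (2, prod_encode (code p, code q))"
| "code (Forall p) = prod_encode (3, code p)"

definition gnum :: "fm \<Rightarrow> tm" where
  "gnum p = num (code p)"

lemma tcode_inject: "tcode s = tcode t \<longleftrightarrow> s = t"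
  by (induction s arbitrary: t; case_tac t) (auto simp: prod_encode_eq)

lemma code_inject: "code p = code q \<longleftrightarrow> p = q"
  by (induction p arbitrary: q; case_tac q) (auto simp: prod_encode_eq tcode_inject)

text \<open>Partial recursive functions: \<open>rec_eval f xs y\<close> means that \<open>f\<close> halts on the arguments
  \<open>xs\<close> with value \<open>y\<close>. Primitive recursion and minimization run over the first argument.\<close>

datatype recf = RZero | RSucc | RProj nat | RComp recf "recf list" | RPrim recf recf | RMin recf

inductive rec_eval :: "recf \<Rightarrow> nat list \<Rightarrow> nat \<Rightarrow> bool" where
  "rec_eval RZero xs 0"
| "rec_eval RSucc [x] (Suc x)"
| "i < length xs \<Longrightarrow> rec_eval (RProj i) xs (xs ! i)"
| "list_all2 (\<lambda>g y. rec_eval g xs y) gs ys \<Longrightarrow> rec_eval f ys z \<Longrightarrow> rec_eval (RComp f gs) xs z"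
| "rec_eval f xs y \<Longrightarrow> rec_eval (RPrim f g) (0 # xs) y"
| "rec_eval (RPrim f g) (n # xs) y \<Longrightarrow> rec_eval g (n # y # xs) z \<Longrightarrow>
     rec_eval (RPrim f g) (Suc n # xs) z"
| "rec_eval f (n # xs) 0 \<Longrightarrow> (\<forall>m < n. \<exists>k. rec_eval f (m # xs) (Suc k)) \<Longrightarrow> rec_eval (RMin f) xs n"

definition rec_enumerable :: "nat set \<Rightarrow> bool" where
  "rec_enumerable A \<longleftrightarrow> (\<exists>f. \<forall>x. x \<in> A \<longleftrightarrow> (\<exists>y. rec_eval f [x] y))"

definition re_theory :: "fm set \<Rightarrow> bool" where
  "re_theory T \<longleftrightarrow> is_theory T \<and> rec_enumerable (code ` T)"


section \<open>Proof predicates and Rosserian sentences\<close>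

text \<open>\<open>Prf(y, x)\<close> says: \<open>y\<close> is the code of a proof in \<open>T\<close> of the formula coded by \<open>x\<close>.
  The coding of proofs is not fixed: \<open>dec y\<close> is the derivation coded by \<open>y\<close>, if any. A
  derivation may have several codes, because for a theory with a merely recursively
  enumerable set of axioms a code has to carry, besides the derivation, evidence that the
  axioms used belong to the theory.\<close>

definition states_provability :: "fm set \<Rightarrow> fm \<Rightarrow> bool" where
  "states_provability T Prf \<longleftrightarrow> (\<exists>dec :: nat \<Rightarrow> fm list option.
      (\<forall>d. d \<noteq> [] \<and> derivation T d \<longrightarrow> (\<exists>y. dec y = Some d)) \<and>
      (\<forall>y x. true_in_N (inst2 Prf (num y) (num x)) \<longleftrightarrow>
        (\<exists>d p. dec y = Some d \<and> x = code p \<and> proof_of T d p)))"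

definition proof_predicate :: "fm set \<Rightarrow> fm \<Rightarrow> bool" where
  "proof_predicate T Prf \<longleftrightarrow>
      fv Prf \<subseteq> {0, 1} \<and> delta1 Prf \<and> states_provability T Prf \<and>
      (\<forall>p. sentence p \<longrightarrow>
        (T \<turnstile> p \<longleftrightarrow> (\<exists>m. robinson_Q \<turnstile> inst2 Prf (num m) (gnum p)))) \<and>
      (\<forall>p. sentence p \<longrightarrow>
        (\<not> T \<turnstile> p \<longleftrightarrow> (\<forall>n. robinson_Q \<turnstile> Neg (inst2 Prf (num n) (gnum p)))))"

text \<open>The instance \<open>R.Pr(#p)\<close> of the Rosserian provability predicate, that is, the sentence
  \<open>\<exists>y. Prf(y, #p) \<and> (\<forall>z<y. \<not> Prf(z, #(\<not>p)))\<close>. The language has no term for the map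
  from the code of a formula to the code of its negation, so only these instances are
  defined; they are all that Rosserian sentences refer to.\<close>

definition R_Pr :: "fm \<Rightarrow> fm \<Rightarrow> fm" where
  "R_Pr Prf p =
    Exists (Conj (inst2 Prf (Var 0) (gnum p))
                 (BAll (Var 0) (Neg (inst2 Prf (Var 0) (gnum (Neg p))))))"

definition rosserian_sentence :: "fm set \<Rightarrow> fm \<Rightarrow> fm \<Rightarrow> bool" where
  "rosserian_sentence T Prf r \<longleftrightarrow> sentence r \<and> T \<turnstile> Iff r (Neg (R_Pr Prf r))"

end

theory Submission imports Defs begin

text \<open>A Rosserian sentence \<open>\<rho>\<close> is neither provable nor refutable in the consistent theory \<open>T\<close>
  (Rosser's theorem, \<open>Rosserian_undecided\<close>). But \<open>T\<close> extends Robinson's arithmetic \<open>Q\<close>, which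
  proves every true \<open>\<Sigma>\<^sub>1\<close>-sentence (\<open>Q_sigma1_complete\<close>) and refutes every false
  \<open>\<Pi>\<^sub>1\<close>-sentence (\<open>Q_refutes_false_pi1\<close>). So a Rosserian \<open>\<Pi>\<^sub>1\<close>-sentence cannot be false and a
  Rosserian \<open>\<Sigma>\<^sub>1\<close>-sentence cannot be true.

  For Rosser's theorem, suppose that \<open>T\<close> decides \<open>\<rho>\<close>. Then \<open>Q\<close> already decides the instance
  \<open>R.Pr(#\<rho>)\<close> (\<open>Q_decides_R_Pr\<close>). If \<open>m\<close> codes a proof of \<open>\<rho>\<close>, then \<open>Q\<close> verifies that \<open>m\<close> is
  such a code and that none of the finitely many \<open>z < m\<close> codes a proof of \<open>\<not>\<rho>\<close>. If \<open>m\<close> codes a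
  proof of \<open>\<not>\<rho>\<close>, then \<open>Q\<close> proves that each \<open>y\<close> is one of \<open>0, \<dots>, m\<close>, and therefore not the code
  of a proof of \<open>\<rho>\<close>, or exceeds \<open>m\<close> and so has the smaller rival \<open>m\<close>. In either case the fixed
  point equivalence contradicts consistency. The argument rests on two facts about the order in
  \<open>Q\<close>: whatever is below a numeral is a numeral (\<open>Q_Less_numD\<close>), and every element is comparable
  with every numeral (\<open>Q_trichotomy\<close>).

  The derivations inside \<open>Q\<close> are not written out in the Hilbert calculus. A \<open>valuation\<close> of a
  theory is a truth assignment to all formulas, open ones included, that respects the
  propositional connectives and makes all theorems true; quantified formulas count as atoms here.
  A formula true under all valuations is provable (\<open>provable_if_all_valuations\<close>). Hence
  propositional and equational reasoning takes place in the metalogic, under a fixed valuation. The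
  valuation changes only where an eigenvariable comes in: in a generalization, or in the elimination
  of an existential quantifier (\<open>valuation_exE\<close>).\<close>

section \<open>Substitution\<close>

abbreviation up :: "(nat \<Rightarrow> tm) \<Rightarrow> nat \<Rightarrow> tm" where
  "up \<sigma> \<equiv> case_nat (Var 0) (\<lambda>n. tlift (\<sigma> n))"

lemma tsubst_tsubst: "tsubst \<sigma> (tsubst \<tau> t) = tsubst (\<lambda>n. tsubst \<sigma> (\<tau> n)) t"
  by (induction t) auto

lemma tsubst_Var [simp]: "tsubst Var t = t"
  by (induction t) auto

lemma tlift_simps [simp]:
  "tlift (Var n) = Var (Suc n)"
  "tlift Zero = Zero"
  "tlift (Succ t) = Succ (tlift t)"
  "tlift (Plus s t) = Plus (tlift s) (tlift t)"
  "tlift (Times s t) = Times (tlift s) (tlift t)"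
  by (simp_all add: tlift_def)

lemma tsubst_case_nat_tlift [simp]: "tsubst (case_nat s \<sigma>) (tlift t) = tsubst \<sigma> t"
  by (simp add: tlift_def tsubst_tsubst)

lemma tsubst_Suc_tlift: "tsubst (\<lambda>n. Var (Suc n)) t = tlift t"
  by (simp add: tlift_def)

lemma tlift_tsubst: "tlift (tsubst \<sigma> t) = tsubst (\<lambda>n. tlift (\<sigma> n)) t"
  by (simp add: tlift_def tsubst_tsubst)

lemma tsubst_num [simp]: "tsubst \<sigma> (num n) = num n"
  by (induction n) auto

lemma tlift_num [simp]: "tlift (num n) = num n"
  by (induction n) auto

text \<open>Lifting commutes with substitution, which makes \<open>up\<close> functorial. This is what lets substitutions
  compose under a quantifier.\<close>

lemma tsubst_up: "tsubst (up \<sigma>) (up \<tau> n) = up (\<lambda>n. tsubst \<sigma> (\<tau> n)) n"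
  by (cases n) (auto simp: tlift_tsubst)

lemma subst_subst: "subst \<sigma> (subst \<tau> p) = subst (\<lambda>n. tsubst \<sigma> (\<tau> n)) p"
  by (induction p arbitrary: \<sigma> \<tau>) (simp_all add: tsubst_tsubst tsubst_up)

lemma up_Var: "case_nat (Var 0) (\<lambda>n. Var (Suc n)) = Var"
  by (rule ext) (simp split: nat.split)

lemma subst_Var [simp]: "subst Var p = p"
  by (induction p) (simp_all add: up_Var)

lemma tsubst_cong: "(\<And>n. n \<in> tfv t \<Longrightarrow> \<sigma> n = \<tau> n) \<Longrightarrow> tsubst \<sigma> t = tsubst \<tau> t"
  by (induction t) auto

lemma subst_cong: "(\<And>n. n \<in> fv p \<Longrightarrow> \<sigma> n = \<tau> n) \<Longrightarrow> subst \<sigma> p = subst \<tau> p"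
proof (induction p arbitrary: \<sigma> \<tau>)
  case (Eq s t)
  then show ?case by (auto intro: tsubst_cong)
next
  case (Forall p)
  have "subst (up \<sigma>) p = subst (up \<tau>) p"
    by (rule Forall.IH) (use Forall.prems in \<open>auto split: nat.split\<close>)
  then show ?case by simp
next
  case (Neg p)
  show ?case using Neg.prems Neg.IH[of \<sigma> \<tau>] by simp
next
  case (Imp p q)
  show ?case using Imp.prems Imp.IH(1)[of \<sigma> \<tau>] Imp.IH(2)[of \<sigma> \<tau>] by simp
qed

lemma subst_sentence: "sentence p \<Longrightarrow> subst \<sigma> p = p"
  using subst_cong[of p \<sigma> Var] by (simp add: sentence_def)

lemma subst_connectives [simp]:
  "subst \<sigma> (Conj p q) = Conj (subst \<sigma> p) (subst \<sigma> q)"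
  "subst \<sigma> (Exists p) = Exists (subst (up \<sigma>) p)"
  by (simp_all add: Conj_def Exists_def)

lemma subst_Less [simp]: "subst \<sigma> (Less s t) = Less (tsubst \<sigma> s) (tsubst \<sigma> t)"
  by (simp add: Less_def tlift_tsubst)

lemma subst_bounded [simp]:
  "subst \<sigma> (BAll t p) = BAll (tsubst \<sigma> t) (subst (up \<sigma>) p)"
  "subst \<sigma> (BEx t p) = BEx (tsubst \<sigma> t) (subst (up \<sigma>) p)"
  by (simp_all add: BAll_def BEx_def tlift_tsubst)

lemma inst_simps [simp]:
  "inst (Eq s t) u = Eq (tsubst (case_nat u Var) s) (tsubst (case_nat u Var) t)"
  "inst (Neg p) u = Neg (inst p u)"
  "inst (Imp p q) u = Imp (inst p u) (inst q u)"
  "inst (Conj p q) u = Conj (inst p u) (inst q u)"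
  "inst (Less s t) u = Less (tsubst (case_nat u Var) s) (tsubst (case_nat u Var) t)"
  by (simp_all add: inst_def)

lemma lift_simps [simp]:
  "lift (Eq s t) = Eq (tlift s) (tlift t)"
  "lift (Neg p) = Neg (lift p)"
  "lift (Imp p q) = Imp (lift p) (lift q)"
  "lift (Less s t) = Less (tlift s) (tlift t)"
  by (simp_all add: lift_def tsubst_Suc_tlift)


section \<open>Propositional completeness\<close>

text \<open>The condition on an entry \<open>q\<close> of a derivation, in terms of the set \<open>S\<close> of the earlier entries.
  As it is monotone in \<open>S\<close> and mentions no positions, derivations can be extended and concatenated
  without any index arithmetic.\<close>

definition justified :: "fm set \<Rightarrow> fm set \<Rightarrow> fm \<Rightarrow> bool" where
  "justified T S q \<longleftrightarrow>
     logical_axiom q \<or> q \<in> T \<or> (\<exists>p \<in> S. Imp p q \<in> S) \<or> (\<exists>p \<in> S. q = Forall p)"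

lemma derivation_iff_justified:
  "derivation T d \<longleftrightarrow> (\<forall>i < length d. justified T (set (take i d)) (d ! i))"
proof -
  have "set (take i d) = (!) d ` {..<i}" if "i < length d" for i
    using nth_image[of i d] that by (simp add: lessThan_atLeast0)
  then have "justified T (set (take i d)) (d ! i) \<longleftrightarrow> logical_axiom (d ! i) \<or> d ! i \<in> T \<or>
      (\<exists>j < i. \<exists>k < i. d ! k = Imp (d ! j) (d ! i)) \<or> (\<exists>j < i. d ! i = Forall (d ! j))"
    if "i < length d" for i
    using that by (simp add: justified_def image_iff Bex_def[of "{..<i}"] eq_commute[of "Imp _ _"])
  then show ?thesis by (auto simp: derivation_def)
qed

lemma derivation_snoc: "derivation T (d @ [q]) \<longleftrightarrow> derivation T d \<and> justified T (set d) q"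
  by (auto simp: derivation_iff_justified All_less_Suc nth_append)

lemma derivation_append: "derivation T d \<Longrightarrow> derivation T d' \<Longrightarrow> derivation T (d @ d')"
proof (induction d' rule: rev_induct)
  case (snoc q d')
  then have "derivation T (d @ d')" "justified T (set (d @ d')) q"
    by (auto simp: derivation_snoc justified_def)
  then show ?case unfolding append_assoc[symmetric] derivation_snoc by blast
qed simp

lemma provable_axiom: "logical_axiom p \<or> p \<in> T \<Longrightarrow> T \<turnstile> p"
  unfolding provable_def proof_of_def
  by (rule exI[of _ "[p]"]) (auto simp: derivation_def)

lemma provable_mp:
  assumes "T \<turnstile> Imp p q" and "T \<turnstile> p"
  shows "T \<turnstile> q"
proof -
  obtain c d where c: "derivation T c" "c \<noteq> []" "last c = Imp p q"
    and d: "derivation T d" "d \<noteq> []" "last d = p"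
    using assms by (auto simp: provable_def proof_of_def)
  have "Imp p q \<in> set (c @ d)" "p \<in> set (c @ d)"
    using c d by (metis UnCI last_in_set set_append)+
  then have "derivation T ((c @ d) @ [q])"
    using derivation_append[OF c(1) d(1)] unfolding derivation_snoc justified_def by blast
  then show ?thesis
    unfolding provable_def proof_of_def by (metis last_snoc snoc_eq_iff_butlast)
qed

lemma provable_gen:
  assumes "T \<turnstile> p"
  shows "T \<turnstile> Forall p"
proof -
  obtain d where d: "derivation T d" "d \<noteq> []" "last d = p"
    using assms by (auto simp: provable_def proof_of_def)
  then have "derivation T (d @ [Forall p])"
    using last_in_set unfolding derivation_snoc justified_def by blast
  then show ?thesis
    unfolding provable_def proof_of_def by (metis last_snoc snoc_eq_iff_butlast)
qed

text \<open>Generalization is left out on purpose: without it the deduction theorem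
  (\<open>mp_closed_assume\<close>) holds for open formulas as well.\<close>

definition mp_closed :: "fm set \<Rightarrow> bool" where
  "mp_closed M \<longleftrightarrow> (\<forall>p. logical_axiom p \<longrightarrow> p \<in> M) \<and> (\<forall>p q. Imp p q \<in> M \<longrightarrow> p \<in> M \<longrightarrow> q \<in> M)"

lemma mp_closedD: "mp_closed M \<Longrightarrow> Imp p q \<in> M \<Longrightarrow> p \<in> M \<Longrightarrow> q \<in> M"
  and mp_closed_axiom: "mp_closed M \<Longrightarrow> logical_axiom p \<Longrightarrow> p \<in> M"
  by (auto simp: mp_closed_def)

lemma mp_closed_weaken: "mp_closed M \<Longrightarrow> q \<in> M \<Longrightarrow> Imp p q \<in> M"
  by (meson logical_axiom.intros(1) mp_closed_axiom mp_closedD)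

lemma mp_closed_self:
  assumes M: "mp_closed M"
  shows "Imp p p \<in> M"
  using mp_closedD[OF M mp_closedD[OF M]] mp_closed_axiom[OF M] logical_axiom.intros(1,2) by meson

text \<open>The deduction theorem: the consequences of \<open>M\<close> under the hypothesis \<open>p\<close> are closed because of the
  first two axiom schemes. Propositional facts about closed sets can therefore be proved in natural
  deduction style, by passing to this larger set.\<close>

lemma mp_closed_assume:
  assumes M: "mp_closed M"
  shows "mp_closed {r. Imp p r \<in> M}"
  unfolding mp_closed_def
proof (intro conjI allI impI)
  fix r assume "logical_axiom r"
  then show "r \<in> {r. Imp p r \<in> M}"
    using M mp_closed_axiom mp_closed_weaken by blast
next
  fix r s assume "Imp r s \<in> {r. Imp p r \<in> M}" "r \<in> {r. Imp p r \<in> M}"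
  moreover have "Imp (Imp p (Imp r s)) (Imp (Imp p r) (Imp p s)) \<in> M"
    using M mp_closed_axiom logical_axiom.intros(2) by blast
  ultimately show "s \<in> {r. Imp p r \<in> M}"
    using M mp_closedD by blast
qed

lemma mp_closed_explosion:
  assumes M: "mp_closed M" and "p \<in> M" "Neg p \<in> M"
  shows "q \<in> M"
proof -
  have "Imp (Neg q) (Neg p) \<in> M"
    using assms mp_closed_weaken by blast
  moreover have "Imp (Imp (Neg q) (Neg p)) (Imp p q) \<in> M"
    using M mp_closed_axiom logical_axiom.intros(3) by blast
  ultimately show ?thesis using assms mp_closedD by blast
qed

text \<open>Under the hypothesis \<open>Neg p\<close> everything follows, in particular the negation of an axiom;
  contraposition turns the axiom into \<open>p\<close>.\<close>

lemma mp_closed_reductio: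
  assumes M: "mp_closed M" and "Imp (Neg p) q \<in> M" "Imp (Neg p) (Neg q) \<in> M"
  shows "p \<in> M"
proof -
  let ?a = "Eq Zero Zero"
  have "Imp (Neg p) (Neg ?a) \<in> M"
    using mp_closed_explosion[OF mp_closed_assume[OF M, of "Neg p"], of q "Neg ?a"] assms by simp
  then have "Imp ?a p \<in> M"
    using M mp_closed_axiom mp_closedD logical_axiom.intros(3) by blast
  then show ?thesis
    using M mp_closed_axiom mp_closedD logical_axiom.intros(7) by blast
qed

lemma mp_closed_reductio':
  assumes M: "mp_closed M" and "Imp p q \<in> M" "Imp p (Neg q) \<in> M"
  shows "Neg p \<in> M"
proof -
  let ?N = "{r. Imp (Neg (Neg p)) r \<in> M}"
  have N: "mp_closed ?N" using mp_closed_assume[OF M] .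
  have "Neg (Neg p) \<in> ?N" using mp_closed_self[OF M] by simp
  then have "p \<in> ?N"
    using mp_closed_reductio[OF N, of p "Neg p"] mp_closed_self[OF N] mp_closed_weaken[OF N] by blast
  moreover have "Imp p q \<in> ?N" "Imp p (Neg q) \<in> ?N"
    using assms mp_closed_weaken[OF M] by auto
  ultimately have "q \<in> ?N" "Neg q \<in> ?N" using mp_closedD[OF N] by blast+
  then show ?thesis using mp_closed_reductio[OF M] by blast
qed

lemma mp_closed_cases:
  assumes M: "mp_closed M" and "Imp p q \<in> M" "Imp (Neg p) q \<in> M"
  shows "q \<in> M"
proof -
  let ?N = "{r. Imp (Neg q) r \<in> M}"
  have N: "mp_closed ?N" using mp_closed_assume[OF M] .
  have nq: "Neg q \<in> ?N" using mp_closed_self[OF M] by simp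
  have "Imp p q \<in> ?N" "Imp (Neg p) q \<in> ?N"
    using assms mp_closed_weaken[OF M] by auto
  then have "q \<in> ?N"
    using mp_closed_reductio'[OF N, of p q] mp_closed_weaken[OF N nq] mp_closedD[OF N] by blast
  then show ?thesis using nq mp_closed_reductio[OF M] by blast
qed

definition valuation :: "fm set \<Rightarrow> (fm \<Rightarrow> bool) \<Rightarrow> bool" where
  "valuation T v \<longleftrightarrow> (\<forall>p q. v (Imp p q) \<longleftrightarrow> (v p \<longrightarrow> v q)) \<and> (\<forall>p. v (Neg p) \<longleftrightarrow> \<not> v p) \<and>
     (\<forall>p. T \<turnstile> p \<longrightarrow> v p)"

lemma valuation_simps:
  assumes "valuation T v"
  shows "v (Imp p q) \<longleftrightarrow> (v p \<longrightarrow> v q)" "v (Neg p) \<longleftrightarrow> \<not> v p" "v (Conj p q) \<longleftrightarrow> v p \<and> v q"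
    "v (Iff p q) \<longleftrightarrow> (v p \<longleftrightarrow> v q)"
  using assms by (auto simp: valuation_def Conj_def Iff_def)

lemma valuation_provable: "valuation T v \<Longrightarrow> T \<turnstile> p \<Longrightarrow> v p"
  by (simp add: valuation_def)

text \<open>Lindenbaum's argument. If \<open>q\<close> is not provable, Zorn's lemma gives a closed set \<open>M\<close> of formulas
  that contains the theorems and is maximal among those that omit \<open>q\<close>. Membership in \<open>M\<close> is then a
  valuation: adding any \<open>p \<notin> M\<close> as a hypothesis yields \<open>q\<close>, so at least one of \<open>p\<close> and
  \<open>Neg p\<close> belongs to \<open>M\<close>.\<close>

theorem provable_if_all_valuations:
  assumes all: "\<And>v. valuation T v \<Longrightarrow> v q"
  shows "T \<turnstile> q"
proof (rule ccontr)
  assume nq: "\<not> T \<turnstile> q"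
  define F where "F = {M. mp_closed M \<and> {p. T \<turnstile> p} \<subseteq> M \<and> q \<notin> M}"
  have "\<exists>M\<in>F. \<forall>X\<in>F. M \<subseteq> X \<longrightarrow> X = M"
  proof (rule subset_Zorn_nonempty)
    have "{p. T \<turnstile> p} \<in> F"
      using nq provable_axiom provable_mp by (auto simp: F_def mp_closed_def)
    then show "F \<noteq> {}" by blast
  next
    fix C assume C: "C \<noteq> {}" "subset.chain F C"
    have mem: "\<And>M. M \<in> C \<Longrightarrow> M \<in> F" using C(2) by (auto simp: subset.chain_def)
    have "mp_closed (\<Union>C)"
      unfolding mp_closed_def
    proof (intro conjI allI impI)
      fix p assume "logical_axiom p"
      then show "p \<in> \<Union>C" using C(1) mem mp_closed_axiom by (fastforce simp: F_def)
    next
      fix p r assume "Imp p r \<in> \<Union>C" "p \<in> \<Union>C"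
      then obtain M N where MN: "M \<in> C" "N \<in> C" "Imp p r \<in> M" "p \<in> N" by blast
      then have "M \<subseteq> N \<or> N \<subseteq> M" using C(2) by (auto simp: subset.chain_def)
      then obtain K where "K \<in> C" "Imp p r \<in> K" "p \<in> K" using MN by blast
      then show "r \<in> \<Union>C" using mem[of K] mp_closedD by (auto simp: F_def)
    qed
    then show "\<Union>C \<in> F" using C(1) mem by (fastforce simp: F_def)
  qed
  then obtain M where "M \<in> F" and max: "\<And>X. X \<in> F \<Longrightarrow> M \<subseteq> X \<Longrightarrow> X = M" by blast
  then have M: "mp_closed M" and TM: "\<And>p. T \<turnstile> p \<Longrightarrow> p \<in> M" and qM: "q \<notin> M"
    by (auto simp: F_def)
  have imp_q: "Imp p q \<in> M" if "p \<notin> M" for p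
  proof (rule ccontr)
    assume "Imp p q \<notin> M"
    moreover have sub: "M \<subseteq> {r. Imp p r \<in> M}" using mp_closed_weaken[OF M] by blast
    ultimately have "{r. Imp p r \<in> M} \<in> F"
      using mp_closed_assume[OF M] TM by (auto simp: F_def)
    then have "{r. Imp p r \<in> M} = M" using max sub by blast
    then show False using that mp_closed_self[OF M] by blast
  qed
  have neg: "Neg p \<in> M \<longleftrightarrow> p \<notin> M" for p
    using mp_closed_explosion[OF M] mp_closed_cases[OF M] imp_q qM by blast
  have imp: "Imp p r \<in> M \<longleftrightarrow> (p \<in> M \<longrightarrow> r \<in> M)" for p r
  proof (cases "p \<in> M")
    case True
    then show ?thesis using mp_closedD[OF M] mp_closed_weaken[OF M] by blast
  next
    case False
    then have "Imp p (Neg p) \<in> M" using neg mp_closed_weaken[OF M] by blast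
    then have "r \<in> {r. Imp p r \<in> M}"
      using mp_closed_explosion[OF mp_closed_assume[OF M]] mp_closed_self[OF M] by blast
    then show ?thesis using False by simp
  qed
  have "valuation T (\<lambda>p. p \<in> M)"
    using neg imp TM by (simp add: valuation_def)
  then show False using all qM by blast
qed


section \<open>Quantifiers and equality under a valuation\<close>

lemma valuation_axiom: "valuation T v \<Longrightarrow> logical_axiom p \<Longrightarrow> v p"
  by (simp add: provable_axiom valuation_provable)

lemma valuation_inst: "valuation T v \<Longrightarrow> v (Forall p) \<Longrightarrow> v (inst p t)"
  using valuation_axiom logical_axiom.intros(4) valuation_simps(1) by blast

lemma valuation_exI:
  assumes "valuation T v" and "v (inst p t)"
  shows "v (Exists p)"
  using assms valuation_inst[of T v "Neg p" t] by (auto simp: Exists_def valuation_simps)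

text \<open>A valuation may make an existential formula true without making any instance true. Instead of a
  witness, the bound variable itself serves as the eigenvariable: the step has to be carried out
  under every valuation \<open>w\<close>, so that it amounts to a theorem of \<open>T\<close> that can be generalized. Facts
  that hold only under \<open>v\<close> do not carry over to \<open>w\<close>; those that are needed must be built into \<open>q\<close> as premises.\<close>

lemma valuation_exE:
  assumes v: "valuation T v" and "v (Exists p)"
    and step: "\<And>w. valuation T w \<Longrightarrow> w p \<Longrightarrow> w (lift q)"
  shows "v q"
proof (rule ccontr)
  assume "\<not> v q"
  have "T \<turnstile> Imp (Neg (lift q)) (Neg p)"
    by (rule provable_if_all_valuations) (use step in \<open>auto simp: valuation_simps\<close>)
  then have "v (Forall (Imp (Neg (lift q)) (Neg p)))"
    using v provable_gen valuation_provable by blast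
  then have "v (Forall (Neg (lift q))) \<longrightarrow> v (Forall (Neg p))"
    using valuation_axiom[OF v logical_axiom.intros(5)] v valuation_simps(1) by blast
  moreover have "v (Forall (Neg (lift q)))"
    using valuation_axiom[OF v logical_axiom.intros(6)[of "Neg q"]] \<open>\<not> v q\<close> v
    by (simp add: valuation_simps)
  ultimately show False
    using assms(2) v by (simp add: Exists_def valuation_simps)
qed

lemma valuation_refl: "valuation T v \<Longrightarrow> v (Eq t t)"
  using valuation_axiom logical_axiom.intros(7) by blast

text \<open>The congruence rules below are all obtained by a choice of \<open>p\<close> that marks with \<open>Var 0\<close> the
  position to be rewritten.\<close>

lemma valuation_leibniz: "valuation T v \<Longrightarrow> v (Eq s t) \<Longrightarrow> v (inst p s) \<Longrightarrow> v (inst p t)"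
  using valuation_axiom[OF _ logical_axiom.intros(8)[of s t p]] by (auto simp: valuation_simps)

lemma valuation_sym: "valuation T v \<Longrightarrow> v (Eq s t) \<Longrightarrow> v (Eq t s)"
  using valuation_leibniz[of T v s t "Eq (Var 0) (tlift s)"] valuation_refl[of T v s] by simp

lemma valuation_trans: "valuation T v \<Longrightarrow> v (Eq s t) \<Longrightarrow> v (Eq t u) \<Longrightarrow> v (Eq s u)"
  using valuation_leibniz[of T v t u "Eq (tlift s) (Var 0)"] by simp

lemma valuation_Succ: "valuation T v \<Longrightarrow> v (Eq s t) \<Longrightarrow> v (Eq (Succ s) (Succ t))"
  using valuation_leibniz[of T v s t "Eq (Succ (tlift s)) (Succ (Var 0))"] valuation_refl[of T v]
  by simp

lemma valuation_Plus:
  assumes v: "valuation T v" and "v (Eq s s')" and "v (Eq t t')"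
  shows "v (Eq (Plus s t) (Plus s' t'))"
proof -
  have "v (Eq (Plus s t) (Plus s' t))"
    using valuation_leibniz[OF v assms(2), of "Eq (Plus (tlift s) (tlift t)) (Plus (Var 0) (tlift t))"]
      valuation_refl[OF v] by simp
  moreover have "v (Eq (Plus s' t) (Plus s' t'))"
    using valuation_leibniz[OF v assms(3), of "Eq (Plus (tlift s') (tlift t)) (Plus (tlift s') (Var 0))"]
      valuation_refl[OF v] by simp
  ultimately show ?thesis using valuation_trans[OF v] by blast
qed

lemma valuation_Times:
  assumes v: "valuation T v" and "v (Eq s s')" and "v (Eq t t')"
  shows "v (Eq (Times s t) (Times s' t'))"
proof -
  have "v (Eq (Times s t) (Times s' t))"
    using valuation_leibniz[OF v assms(2), of "Eq (Times (tlift s) (tlift t)) (Times (Var 0) (tlift t))"]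
      valuation_refl[OF v] by simp
  moreover have "v (Eq (Times s' t) (Times s' t'))"
    using valuation_leibniz[OF v assms(3), of "Eq (Times (tlift s') (tlift t)) (Times (tlift s') (Var 0))"]
      valuation_refl[OF v] by simp
  ultimately show ?thesis using valuation_trans[OF v] by blast
qed

lemma valuation_Less:
  assumes v: "valuation T v" and "v (Eq s s')" and "v (Eq t t')" and "v (Less s t)"
  shows "v (Less s' t')"
proof -
  have "v (Less s' t)"
    using valuation_leibniz[OF v assms(2), of "Less (Var 0) (tlift t)"] assms(4) by simp
  then show ?thesis
    using valuation_leibniz[OF v assms(3), of "Less (tlift s') (Var 0)"] by simp
qed

lemma valuation_LessI:
  assumes v: "valuation T v" and "v (Eq (Plus u (Succ s)) t)"
  shows "v (Less s t)"
  unfolding Less_def using assms(2) by (intro valuation_exI[OF v, of _ u]) simp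


section \<open>Numerals and the order in Robinson's arithmetic\<close>

abbreviation Qval :: "(fm \<Rightarrow> bool) \<Rightarrow> bool" where
  "Qval \<equiv> valuation robinson_Q"

lemma Qval_axiom: "Qval v \<Longrightarrow> p \<in> robinson_Q \<Longrightarrow> v p"
  by (simp add: provable_axiom valuation_provable)

lemma inst_Forall: "inst (Forall p) t = Forall (subst (up (case_nat t Var)) p)"
  by (simp add: inst_def)

lemma inst_inst: "inst (subst (up (case_nat s Var)) p) t = subst (case_nat t (case_nat s Var)) p"
  unfolding inst_def subst_subst by (rule arg_cong2[where f = subst]) (auto split: nat.split)

lemma Qval_inst1: "Qval v \<Longrightarrow> Forall p \<in> robinson_Q \<Longrightarrow> v (inst p t)"
  using Qval_axiom valuation_inst by blast

lemma Qval_inst2: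
  assumes "Qval v" and "Forall (Forall p) \<in> robinson_Q"
  shows "v (inst2 p t s)"
  using Qval_inst1[OF assms, of s] valuation_inst[OF assms(1)]
  by (simp add: inst_Forall inst2_def flip: inst_inst)

lemma Q_Succ_not_Zero: "Qval v \<Longrightarrow> \<not> v (Eq (Succ t) Zero)"
  using Qval_inst1[of v "Neg (Eq (Succ (Var 0)) Zero)" t]
  by (simp add: robinson_Q_def valuation_simps)

lemma Q_Succ_inject: "Qval v \<Longrightarrow> v (Eq (Succ s) (Succ t)) \<Longrightarrow> v (Eq s t)"
  using Qval_inst2[of v "Imp (Eq (Succ (Var 1)) (Succ (Var 0))) (Eq (Var 1) (Var 0))" t s]
  by (simp add: robinson_Q_def valuation_simps inst2_def)

lemma Q_Zero_or_Succ: "Qval v \<Longrightarrow> v (Eq t Zero) \<or> v (Exists (Eq (tlift t) (Succ (Var 0))))"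
  using Qval_inst1[of v "Imp (Neg (Eq (Var 0) Zero)) (Exists (Eq (Var 1) (Succ (Var 0))))" t]
  by (auto simp: robinson_Q_def valuation_simps inst_def)

lemma Q_Plus_Zero: "Qval v \<Longrightarrow> v (Eq (Plus t Zero) t)"
  using Qval_inst1[of v "Eq (Plus (Var 0) Zero) (Var 0)" t]
  by (simp add: robinson_Q_def)

lemma Q_Plus_Succ: "Qval v \<Longrightarrow> v (Eq (Plus s (Succ t)) (Succ (Plus s t)))"
  using Qval_inst2[of v "Eq (Plus (Var 1) (Succ (Var 0))) (Succ (Plus (Var 1) (Var 0)))" t s]
  by (simp add: robinson_Q_def inst2_def)

lemma Q_Times_Zero: "Qval v \<Longrightarrow> v (Eq (Times t Zero) Zero)"
  using Qval_inst1[of v "Eq (Times (Var 0) Zero) Zero" t]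
  by (simp add: robinson_Q_def)

lemma Q_Times_Succ: "Qval v \<Longrightarrow> v (Eq (Times s (Succ t)) (Plus (Times s t) s))"
  using Qval_inst2[of v "Eq (Times (Var 1) (Succ (Var 0))) (Plus (Times (Var 1) (Var 0)) (Var 1))" t s]
  by (simp add: robinson_Q_def inst2_def)

lemma Q_cases:
  assumes v: "Qval v" and "v (Eq t Zero) \<Longrightarrow> v q"
    and "\<And>w. Qval w \<Longrightarrow> w (Eq (tlift t) (Succ (Var 0))) \<Longrightarrow> w (lift q)"
  shows "v q"
  using Q_Zero_or_Succ[OF v, of t] valuation_exE[OF v] assms(2,3) by blast

lemma Q_Plus_num: "Qval v \<Longrightarrow> v (Eq (Plus (num a) (num b)) (num (a + b)))"
proof (induction b)
  case (Suc b)
  then have "v (Eq (Succ (Plus (num a) (num b))) (num (a + Suc b)))"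
    using valuation_Succ by fastforce
  then show ?case using Suc.prems Q_Plus_Succ valuation_trans by fastforce
qed (simp add: Q_Plus_Zero)

lemma Q_Times_num: "Qval v \<Longrightarrow> v (Eq (Times (num a) (num b)) (num (a * b)))"
proof (induction b)
  case (Suc b)
  have "v (Eq (Plus (Times (num a) (num b)) (num a)) (Plus (num (a * b)) (num a)))"
    using Suc valuation_Plus valuation_refl by blast
  moreover have "v (Eq (Plus (num (a * b)) (num a)) (num (a * Suc b)))"
    using Q_Plus_num[OF Suc.prems, of "a * b" a] by (simp add: add.commute)
  ultimately show ?case
    using Q_Times_Succ[OF Suc.prems, of "num a" "num b"] valuation_trans[OF Suc.prems]
    unfolding num.simps by metis
qed (simp add: Q_Times_Zero)

lemma Q_num_inject: "Qval v \<Longrightarrow> v (Eq (num a) (num b)) \<longleftrightarrow> a = b"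
proof (induction a arbitrary: b)
  case 0
  then show ?case
    using Q_Succ_not_Zero valuation_sym[OF 0] valuation_refl[OF 0] by (cases b) fastforce+
next
  case (Suc a)
  show ?case
  proof (cases b)
    case 0
    then show ?thesis using Q_Succ_not_Zero[OF Suc.prems] by simp
  next
    case (Suc b')
    then show ?thesis
      using Suc.IH[OF Suc.prems, of b'] Q_Succ_inject[OF Suc.prems] valuation_refl[OF Suc.prems]
      by auto
  qed
qed

text \<open>\<open>Q\<close> has no induction, so that this commutation is available only for numerals \<open>n\<close>, by induction in
  the metatheory.\<close>

lemma Q_Succ_Plus_num: "Qval v \<Longrightarrow> v (Eq (Plus (Succ t) (num n)) (Succ (Plus t (num n))))"
proof (induction n)
  case 0
  then show ?case
    using Q_Plus_Zero valuation_trans valuation_sym valuation_Succ by (metis num.simps(1))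
next
  case (Suc n)
  note v = Suc.prems
  have "v (Eq (Plus (Succ t) (num (Suc n))) (Succ (Plus (Succ t) (num n))))"
    using Q_Plus_Succ[OF v] by simp
  moreover have "v (Eq (Succ (Plus (Succ t) (num n))) (Succ (Succ (Plus t (num n)))))"
    using Suc valuation_Succ by blast
  moreover have "v (Eq (Succ (Succ (Plus t (num n)))) (Succ (Plus t (num (Suc n)))))"
    using Q_Plus_Succ[OF v] valuation_sym[OF v] valuation_Succ[OF v] by simp
  ultimately show ?case using valuation_trans[OF v] by metis
qed

text \<open>The formula \<open>t = 0 \<or> \<dots> \<or> t = n - 1\<close>. The disjunction has to be a formula of the object
  language in order to be the conclusion of an existential elimination.\<close>

primrec below :: "tm \<Rightarrow> nat \<Rightarrow> fm" where
  "below t 0 = Neg (Eq Zero Zero)"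
| "below t (Suc n) = Imp (Neg (below t n)) (Eq t (num n))"

lemma valuation_below: "valuation T v \<Longrightarrow> v (below t n) \<longleftrightarrow> (\<exists>k<n. v (Eq t (num k)))"
  by (induction n) (auto simp: valuation_simps valuation_refl less_Suc_eq)

lemma lift_below [simp]: "lift (below t n) = below (tlift t) n"
  by (induction n) simp_all

text \<open>Let \<open>z + S t = S n\<close>, so that \<open>z + t = n\<close>. Either \<open>t\<close> is \<open>0\<close>, or \<open>t = S t'\<close> and
  \<open>z + S t' = n\<close> says \<open>t' < n\<close>, to which the induction hypothesis applies.\<close>

lemma Q_Less_num_below: "Qval v \<Longrightarrow> v (Less t (num n)) \<Longrightarrow> v (below t n)"
proof (induction n arbitrary: v t)
  case 0
  show ?case
  proof (rule valuation_exE[OF 0(1)])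
    show "v (Exists (Eq (Plus (Var 0) (Succ (tlift t))) Zero))"
      using 0(2) by (simp add: Less_def)
  next
    fix w assume w: "Qval w" "w (Eq (Plus (Var 0) (Succ (tlift t))) Zero)"
    then have "w (Eq (Succ (Plus (Var 0) (tlift t))) Zero)"
      using Q_Plus_Succ[OF w(1)] valuation_sym[OF w(1)] valuation_trans[OF w(1)] by metis
    then show "w (lift (below t 0))" using Q_Succ_not_Zero w(1) by blast
  qed
next
  case (Suc n)
  show ?case
  proof (rule valuation_exE[OF Suc.prems(1)])
    show "v (Exists (Eq (Plus (Var 0) (Succ (tlift t))) (Succ (num n))))"
      using Suc.prems(2) by (simp add: Less_def)
  next
    fix w assume w: "Qval w" and eq: "w (Eq (Plus (Var 0) (Succ (tlift t))) (Succ (num n)))"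
    \<comment> \<open>the equation for \<open>z\<close> is a premise of \<open>?q\<close> because the second elimination changes the valuation\<close>
    let ?q = "Imp (Eq (Plus (Var 0) (tlift t)) (num n)) (below (tlift t) (Suc n))"
    have "w ?q"
    proof (rule Q_cases[OF w, of "tlift t"])
      assume "w (Eq (tlift t) Zero)"
      then have "w (below (tlift t) (Suc n))"
        unfolding valuation_below[OF w] by (intro exI[of _ 0]) simp
      then show "w ?q" by (simp add: valuation_simps[OF w])
    next
      fix u assume u: "Qval u" and succ: "u (Eq (tlift (tlift t)) (Succ (Var 0)))"
      have "u (below (tlift (tlift t)) (Suc n))" if "u (Eq (Plus (Var 1) (tlift (tlift t))) (num n))"
      proof -
        have "u (Eq (Plus (Var 1) (Succ (Var 0))) (num n))"
          using that succ valuation_Plus[OF u] valuation_refl[OF u] valuation_sym[OF u]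
            valuation_trans[OF u] by metis
        then have "u (below (Var 0) n)"
          using Suc.IH[OF u] valuation_LessI[OF u] by blast
        then obtain k where "k < n" "u (Eq (Var 0) (num k))"
          using valuation_below[OF u] by blast
        then have "u (Eq (tlift (tlift t)) (num (Suc k)))" "Suc k < Suc n"
          using succ valuation_Succ[OF u] valuation_trans[OF u] by auto
        then show ?thesis using valuation_below[OF u] by blast
      qed
      then show "u (lift ?q)"
        by (simp del: below.simps add: valuation_simps[OF u])
    qed
    moreover have "w (Eq (Plus (Var 0) (tlift t)) (num n))"
      using eq Q_Plus_Succ[OF w] Q_Succ_inject[OF w] valuation_sym[OF w] valuation_trans[OF w]
      by metis
    ultimately show "w (lift (below t (Suc n)))"
      by (simp del: below.simps add: valuation_simps[OF w])
  qed
qed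

lemma Q_Less_numD: "Qval v \<Longrightarrow> v (Less t (num n)) \<Longrightarrow> \<exists>k<n. v (Eq t (num k))"
  using Q_Less_num_below valuation_below by blast

lemma Q_Less_num_num:
  assumes v: "Qval v"
  shows "v (Less (num a) (num b)) \<longleftrightarrow> a < b"
proof
  assume "v (Less (num a) (num b))"
  then show "a < b" using Q_Less_numD[OF v, of "num a" b] by (auto simp: Q_num_inject[OF v])
next
  assume "a < b"
  then show "v (Less (num a) (num b))"
    using valuation_LessI[OF v, of "num (b - Suc a)" "num a" "num b"]
      Q_Plus_num[OF v, of "b - Suc a" "Suc a"] by simp
qed

text \<open>For the step, let \<open>z + S m = t\<close> witness \<open>m < t\<close>. If \<open>z = 0\<close>, then \<open>t\<close> is the numeral of
  \<open>m + 1\<close>. If \<open>z = S z'\<close>, then \<open>S z' + S m = S (z' + S m) = z' + S (S m)\<close>, so that \<open>z'\<close> witnesses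
  \<open>m + 1 < t\<close>.\<close>

lemma Q_trichotomy:
  "Qval v \<Longrightarrow> (\<exists>k\<le>m. v (Eq t (num k))) \<or> v (Less (num m) t)"
proof (induction m arbitrary: v t)
  case 0
  let ?q = "Imp (Neg (Eq t Zero)) (Less Zero t)"
  have "v ?q"
  proof (rule Q_cases[OF 0, of t])
    assume "v (Eq t Zero)"
    then show "v ?q" by (simp add: valuation_simps[OF 0])
  next
    fix w assume w: "Qval w" and succ: "w (Eq (tlift t) (Succ (Var 0)))"
    have "w (Eq (Plus (Var 0) (Succ Zero)) (Succ (Var 0)))"
      using Q_Plus_Succ[OF w] Q_Plus_Zero[OF w] valuation_Succ[OF w] valuation_trans[OF w] by metis
    then have "w (Less Zero (tlift t))"
      using succ valuation_LessI[OF w] valuation_trans[OF w] valuation_sym[OF w] by metis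
    then show "w (lift ?q)" by (simp add: valuation_simps[OF w])
  qed
  then show ?case by (auto simp: valuation_simps[OF 0])
next
  case (Suc m)
  note v = Suc.prems
  let ?q = "Imp (Neg (below t (Suc (Suc m)))) (Less (num (Suc m)) t)"
  have "v ?q" if "v (Less (num m) t)"
  proof (rule valuation_exE[OF v])
    show "v (Exists (Eq (Plus (Var 0) (num (Suc m))) (tlift t)))"
      using that by (simp add: Less_def)
  next
    fix w assume w: "Qval w" and eq: "w (Eq (Plus (Var 0) (num (Suc m))) (tlift t))"
    \<comment> \<open>as above, the equation for \<open>z\<close> must survive the case distinction on \<open>z\<close>\<close>
    let ?r = "Imp (Eq (Plus (Var 0) (num (Suc m))) (tlift t)) (lift ?q)"
    have "w ?r"
    proof (rule Q_cases[OF w, of "Var 0"])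
      assume "w (Eq (Var 0) Zero)"
      then have "w (Eq (Plus (Var 0) (num (Suc m))) (num (Suc m)))"
        using Q_Plus_num[OF w, of 0 "Suc m"] valuation_Plus[OF w] valuation_refl[OF w]
          valuation_trans[OF w] by (metis add_0 num.simps(1))
      then have "w (Eq (tlift t) (num (Suc m)))"
        using eq valuation_trans[OF w] valuation_sym[OF w] by metis
      then have "w (below (tlift t) (Suc (Suc m)))"
        unfolding valuation_below[OF w] by blast
      then show "w ?r" by (simp del: below.simps add: valuation_simps[OF w])
    next
      fix u assume u: "Qval u" and "u (Eq (tlift (Var 0)) (Succ (Var 0)))"
      then have succ: "u (Eq (Var 1) (Succ (Var 0)))" by simp
      let ?n = "num (Suc m)"
      have "u (Less ?n (tlift (tlift t)))" if "u (Eq (Plus (Var 1) ?n) (tlift (tlift t)))"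
      proof (rule valuation_LessI[OF u])
        have "u (Eq (Plus (Var 0) (Succ ?n)) (Plus (Succ (Var 0)) ?n))"
          using Q_Plus_Succ[OF u] Q_Succ_Plus_num[OF u] valuation_trans[OF u] valuation_sym[OF u]
          by metis
        moreover have "u (Eq (Plus (Succ (Var 0)) ?n) (Plus (Var 1) ?n))"
          using succ valuation_Plus[OF u] valuation_refl[OF u] valuation_sym[OF u] by blast
        ultimately show "u (Eq (Plus (Var 0) (Succ ?n)) (tlift (tlift t)))"
          using that valuation_trans[OF u] by metis
      qed
      then show "u (lift ?r)"
        by (simp del: below.simps add: valuation_simps[OF u])
    qed
    then show "w (lift ?q)" using eq by (simp del: below.simps add: valuation_simps[OF w])
  qed
  moreover have ?case if "\<exists>k\<le>m. v (Eq t (num k))"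
    using that le_SucI by blast
  ultimately show ?case
    using Suc.IH[OF v, of t]
    unfolding valuation_simps[OF v] valuation_below[OF v] less_Suc_eq_le by blast
qed


section \<open>Completeness of Robinson's arithmetic for true existential sentences\<close>

text \<open>A formula with one distinguished argument place and otherwise closed, as a function of the term
  that is put there. With this encoding instances, bounded quantification and Leibniz' law need no
  computation with de Bruijn indices.\<close>

definition predicate :: "(tm \<Rightarrow> fm) \<Rightarrow> bool" where
  "predicate P \<longleftrightarrow> (\<forall>\<sigma> t. subst \<sigma> (P t) = P (tsubst \<sigma> t))"

lemma predicate_inst: "predicate P \<Longrightarrow> inst (P (Var 0)) t = P t"
  by (simp add: predicate_def inst_def)

lemma predicate_Neg: "predicate P \<Longrightarrow> predicate (\<lambda>t. Neg (P t))"
  by (simp add: predicate_def)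

lemma predicate_leibniz:
  assumes "predicate P" "valuation T v" "v (Eq s t)" "v (P s)"
  shows "v (P t)"
  using valuation_leibniz[OF assms(2,3), of "P (Var 0)"] assms predicate_inst by metis

lemma Q_BAll_intro:
  assumes P: "predicate P" and closed: "tlift t = t" and t: "robinson_Q \<turnstile> Eq t (num n)"
    and all: "\<And>k. k < n \<Longrightarrow> robinson_Q \<turnstile> P (num k)"
  shows "robinson_Q \<turnstile> BAll t (P (Var 0))"
  unfolding BAll_def closed
proof (intro provable_gen provable_if_all_valuations)
  fix v assume v: "Qval v"
  have "v (P (Var 0))" if "v (Less (Var 0) t)"
  proof -
    have "v (Less (Var 0) (num n))"
      using that valuation_Less[OF v valuation_refl[OF v]] valuation_provable[OF v t] by blast
    then obtain k where "k < n" "v (Eq (Var 0) (num k))" using Q_Less_numD[OF v] by blast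
    then show ?thesis
      using predicate_leibniz[OF P v valuation_sym[OF v]] all valuation_provable[OF v] by blast
  qed
  then show "v (Imp (Less (Var 0) t) (P (Var 0)))" by (simp add: valuation_simps[OF v])
qed

lemma Q_BAll_elim:
  assumes P: "predicate P" and closed: "tlift t = t" and t: "robinson_Q \<turnstile> Eq t (num n)"
    and v: "Qval v" and "v (BAll t (P (Var 0)))" and "k < n"
  shows "v (P (num k))"
proof -
  have "tsubst (case_nat (num k) Var) t = t"
    using tsubst_case_nat_tlift[of "num k" Var t] closed by simp
  then have "v (Less (num k) t) \<longrightarrow> v (P (num k))"
    using valuation_inst[OF v, of _ "num k"] assms(5)
    by (fastforce simp: BAll_def closed valuation_simps[OF v] predicate_inst[OF P])
  moreover have "v (Less (num k) (num n))" using Q_Less_num_num[OF v] \<open>k < n\<close> by blast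
  then have "v (Less (num k) t)"
    using valuation_Less[OF v valuation_refl[OF v]] valuation_sym[OF v] valuation_provable[OF v t]
    by blast
  ultimately show ?thesis by blast
qed

lemma valuation_BEx:
  assumes v: "valuation T v"
  shows "v (BEx t p) \<longleftrightarrow> \<not> v (BAll t (Neg p))"
proof -
  let ?c = "Conj (Less (Var 0) (tlift t)) p" and ?i = "Imp (Less (Var 0) (tlift t)) (Neg p)"
  have "T \<turnstile> Imp (Neg ?c) ?i" "T \<turnstile> Imp ?i (Neg ?c)"
    by (rule provable_if_all_valuations; simp add: valuation_simps)+
  then have "v (Imp (Forall (Neg ?c)) (Forall ?i))" "v (Imp (Forall ?i) (Forall (Neg ?c)))"
    using v valuation_simps(1)[OF v] valuation_axiom[OF v logical_axiom.intros(5)]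
      valuation_provable[OF v provable_gen] by blast+
  then show ?thesis
    by (auto simp: BEx_def BAll_def Exists_def valuation_simps[OF v])
qed

abbreviation nums :: "(nat \<Rightarrow> nat) \<Rightarrow> nat \<Rightarrow> tm" where
  "nums e \<equiv> \<lambda>n. num (e n)"

lemma case_nat_nums: "case_nat (num k) (nums e) = nums (case_nat k e)"
  by (rule ext) (simp split: nat.split)

lemma predicate_nums: "predicate (\<lambda>s. subst (case_nat s (nums e)) p)"
  unfolding predicate_def subst_subst
  by (intro allI arg_cong2[where f = subst] ext refl) (simp split: nat.split)

lemma tlift_tsubst_nums: "tlift (tsubst (nums e) t) = tsubst (nums e) t"
  by (simp add: tlift_tsubst)

lemma Q_val: "Qval v \<Longrightarrow> v (Eq (tsubst (nums e) t) (num (val e t)))"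
proof (induction t)
  case (Plus s t)
  then show ?case
    using valuation_trans[OF Plus.prems valuation_Plus[OF Plus.prems] Q_Plus_num[OF Plus.prems, of "val e s" "val e t"]]
    by simp
next
  case (Times s t)
  then show ?case
    using valuation_trans[OF Times.prems valuation_Times[OF Times.prems] Q_Times_num[OF Times.prems, of "val e s" "val e t"]]
    by simp
qed (simp_all add: valuation_refl valuation_Succ)

lemma Q_provable_val: "robinson_Q \<turnstile> Eq (tsubst (nums e) t) (num (val e t))"
  by (rule provable_if_all_valuations) (rule Q_val)

lemma Q_Eq_iff: "Qval v \<Longrightarrow> v (Eq (tsubst (nums e) s) (tsubst (nums e) t)) \<longleftrightarrow> val e s = val e t"
  using Q_val[of v e s] Q_val[of v e t] Q_num_inject[of v "val e s" "val e t"]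
    valuation_sym[of robinson_Q v] valuation_trans[of robinson_Q v] by metis

lemma Q_Less_iff: "Qval v \<Longrightarrow> v (Less (tsubst (nums e) s) (tsubst (nums e) t)) \<longleftrightarrow> val e s < val e t"
  using Q_val[of v e s] Q_val[of v e t] Q_Less_num_num[of v "val e s" "val e t"]
    valuation_sym[of robinson_Q v] valuation_Less[of robinson_Q v] by metis

lemma val_tsubst: "val e (tsubst \<sigma> t) = val (\<lambda>n. val e (\<sigma> n)) t"
  by (induction t) auto

lemma val_tlift [simp]: "val (case_nat x e) (tlift t) = val e t"
  by (simp add: tlift_def val_tsubst)

lemma sat_simps [simp]:
  "sat e (Conj p q) \<longleftrightarrow> sat e p \<and> sat e q"
  "sat e (Exists p) \<longleftrightarrow> (\<exists>x. sat (case_nat x e) p)"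
  by (simp_all add: Conj_def Exists_def)

lemma sat_Less [simp]: "sat e (Less s t) \<longleftrightarrow> val e s < val e t"
  by (simp add: Less_def less_iff_Suc_add eq_commute[of "val e t"] add.commute[of "val e s"])

lemma sat_bounded [simp]:
  "sat e (BAll t p) \<longleftrightarrow> (\<forall>x < val e t. sat (case_nat x e) p)"
  "sat e (BEx t p) \<longleftrightarrow> (\<exists>x < val e t. sat (case_nat x e) p)"
  by (simp_all add: BAll_def BEx_def)

text \<open>Completeness is proved for formulas with free variables, which take the numerals of their values.\<close>

definition verifies :: "(nat \<Rightarrow> nat) \<Rightarrow> fm \<Rightarrow> bool" where
  "verifies e p \<longleftrightarrow> robinson_Q \<turnstile> subst (nums e) p"

lemma verifies_iff: "verifies e p \<longleftrightarrow> (\<forall>v. Qval v \<longrightarrow> v (subst (nums e) p))"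
  unfolding verifies_def using provable_if_all_valuations valuation_provable by blast

lemma up_nums: "up (nums e) = case_nat (Var 0) (nums e)"
  by (rule ext) (simp split: nat.split)

lemma inst_up_nums: "inst (subst (up (nums e)) p) (num k) = subst (nums (case_nat k e)) p"
  using predicate_inst[OF predicate_nums] by (simp add: up_nums case_nat_nums)

lemma verifies_BAll:
  assumes "\<And>k. k < val e t \<Longrightarrow> verifies (case_nat k e) p"
  shows "verifies e (BAll t p)"
  using Q_BAll_intro[OF predicate_nums tlift_tsubst_nums Q_provable_val] assms
  by (simp add: verifies_def up_nums case_nat_nums)

lemma refutes_BAll:
  assumes "k < val e t" and "verifies (case_nat k e) (Neg p)"
  shows "verifies e (Neg (BAll t p))"
  unfolding verifies_iff
proof (intro allI impI)
  fix v assume v: "Qval v"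
  have "v (subst (nums (case_nat k e)) (Neg p))"
    using assms(2) v unfolding verifies_iff by blast
  then have "\<not> v (subst (case_nat (num k) (nums e)) p)"
    by (simp add: case_nat_nums valuation_simps[OF v])
  then show "v (subst (nums e) (Neg (BAll t p)))"
    using Q_BAll_elim[OF predicate_nums tlift_tsubst_nums Q_provable_val v _ assms(1)]
    by (auto simp: valuation_simps[OF v] up_nums)
qed

lemma verifies_BEx_iff: "verifies e (BEx t p) \<longleftrightarrow> verifies e (Neg (BAll t (Neg p)))"
  and refutes_BEx_iff: "verifies e (Neg (BEx t p)) \<longleftrightarrow> verifies e (BAll t (Neg p))"
  by (auto simp: verifies_iff valuation_BEx valuation_simps)

lemma verifies_Neg_Neg: "verifies e (Neg (Neg p)) \<longleftrightarrow> verifies e p"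
  by (auto simp: verifies_iff valuation_simps)

lemma refutes_Forall: "verifies (case_nat k e) (Neg p) \<Longrightarrow> verifies e (Neg (Forall p))"
  unfolding verifies_iff
  using valuation_inst[of robinson_Q _ "subst (up (nums e)) p" "num k"] unfolding inst_up_nums
  by (auto simp: valuation_simps)

lemma verifies_Exists: "verifies (case_nat k e) p \<Longrightarrow> verifies e (Exists p)"
  unfolding Exists_def by (intro refutes_Forall[of k]) (simp add: verifies_Neg_Neg)

lemma verifies_Imp: "verifies e (Neg p) \<or> verifies e q \<Longrightarrow> verifies e (Imp p q)"
  and refutes_Imp: "verifies e p \<Longrightarrow> verifies e (Neg q) \<Longrightarrow> verifies e (Neg (Imp p q))"
  by (auto simp: verifies_iff valuation_simps)

lemma delta0_decided:
  "delta0 p \<Longrightarrow> (sat e p \<longrightarrow> verifies e p) \<and> (\<not> sat e p \<longrightarrow> verifies e (Neg p))"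
proof (induction arbitrary: e rule: delta0.induct)
  case (1 s t)
  then show ?case by (auto simp: verifies_iff Q_Eq_iff valuation_simps)
next
  case (2 s t)
  then show ?case by (auto simp: verifies_iff Q_Less_iff valuation_simps)
next
  case (3 p)
  then show ?case by (simp add: verifies_Neg_Neg)
next
  case (4 p q)
  then show ?case using verifies_Imp refutes_Imp by auto
next
  case (5 p t)
  then show ?case using verifies_BAll refutes_BAll by auto
next
  case (6 p t)
  have "verifies (case_nat k e) (Neg (Neg p))" if "sat (case_nat k e) p" for k
    using 6 that by (simp add: verifies_Neg_Neg)
  then show ?case using 6 verifies_BAll[of e t "Neg p"] refutes_BAll[of _ e t "Neg p"]
    by (auto simp: verifies_BEx_iff refutes_BEx_iff)
qed

text \<open>The two classes are defined by mutual induction, with negation exchanging them, so that the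
  provability of true \<open>\<Sigma>\<^sub>1\<close>-formulas and the refutability of false \<open>\<Pi>\<^sub>1\<close>-formulas must be proved
  together. Only a bounded universal quantifier over a \<open>\<Sigma>\<^sub>1\<close>-formula, or dually, takes
  the induction beyond logic: it reduces to finitely many instances.\<close>

lemma sigma1_verified_pi1_refuted:
  shows "sigma1 p \<Longrightarrow> sat e p \<Longrightarrow> verifies e p"
    and "pi1 q \<Longrightarrow> \<not> sat e q \<Longrightarrow> verifies e (Neg q)"
proof (induction p and q arbitrary: e and e rule: sigma1_pi1.inducts)
  case (3 p q)
  then show ?case using verifies_Imp by auto
next
  case (4 p t)
  then show ?case using verifies_BAll by auto
next
  case (5 p)
  then show ?case using verifies_Exists by auto
next
  case (8 p q)
  then show ?case using refutes_Imp by auto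
next
  case (9 p t)
  then show ?case using verifies_BAll[of e t "Neg p"] by (auto simp: refutes_BEx_iff)
next
  case (10 p)
  then show ?case using refutes_Forall by auto
qed (auto simp: delta0_decided verifies_Neg_Neg)

theorem Q_sigma1_complete:
  assumes "sigma1 p" "sentence p" "true_in_N p"
  shows "robinson_Q \<turnstile> p"
  using sigma1_verified_pi1_refuted(1)[of p "\<lambda>_. 0"] assms
  by (simp add: verifies_def true_in_N_def subst_sentence)

theorem Q_refutes_false_pi1:
  assumes "pi1 p" "sentence p" "\<not> true_in_N p"
  shows "robinson_Q \<turnstile> Neg p"
  using sigma1_verified_pi1_refuted(2)[of p "\<lambda>_. 0"] assms
  by (simp add: verifies_def true_in_N_def subst_sentence)


section \<open>Rosser's argument\<close>

lemma predicate_inst2: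
  assumes "fv Prf \<subseteq> {0, 1}"
  shows "predicate (\<lambda>s. inst2 Prf s (num n))"
  unfolding predicate_def inst2_def subst_subst
  by (intro allI subst_cong) (use assms in \<open>auto split: nat.split\<close>)

lemma inst_BAll: "predicate R \<Longrightarrow> inst (BAll (Var 0) (R (Var 0))) t = BAll t (R (Var 0))"
  by (simp add: inst_def predicate_def)

lemma Q_Rosser_witness:
  assumes P: "predicate P" and R: "predicate R"
    and "robinson_Q \<turnstile> P (num m)" and "\<And>n. n < m \<Longrightarrow> robinson_Q \<turnstile> R (num n)"
  shows "robinson_Q \<turnstile> Exists (Conj (P (Var 0)) (BAll (Var 0) (R (Var 0))))"
proof (rule provable_if_all_valuations)
  fix v assume v: "Qval v"
  have "robinson_Q \<turnstile> Eq (num m) (num m)"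
    by (rule provable_axiom) (simp add: logical_axiom.intros)
  then have "v (BAll (num m) (R (Var 0)))"
    using Q_BAll_intro[OF R] assms(4) valuation_provable[OF v] by simp
  then show "v (Exists (Conj (P (Var 0)) (BAll (Var 0) (R (Var 0)))))"
    using valuation_provable[OF v assms(3)]
    by (intro valuation_exI[OF v, of _ "num m"])
      (simp add: predicate_inst[OF P] inst_BAll[OF R] valuation_simps[OF v])
qed

text \<open>Under a valuation that makes the matrix true at \<open>y\<close>, trichotomy leaves two cases: \<open>m < y\<close> makes
  \<open>R m\<close> true, and \<open>y = k\<close> with \<open>k \<le> m\<close> makes \<open>P k\<close> true; both are refutable.\<close>

lemma Q_Rosser_refuted:
  assumes P: "predicate P" and R: "predicate R"
    and "\<And>n. n \<le> m \<Longrightarrow> robinson_Q \<turnstile> Neg (P (num n))" and "robinson_Q \<turnstile> Neg (R (num m))"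
  shows "robinson_Q \<turnstile> Neg (Exists (Conj (P (Var 0)) (BAll (Var 0) (R (Var 0)))))"
proof (rule provable_if_all_valuations)
  fix v assume v: "Qval v"
  have "\<not> v (Exists (Conj (P (Var 0)) (BAll (Var 0) (R (Var 0)))))"
  proof
    assume "v (Exists (Conj (P (Var 0)) (BAll (Var 0) (R (Var 0)))))"
    \<comment> \<open>a refutable formula that stands for falsity and has no free variables\<close>
    then have "v (Neg (Eq Zero Zero))"
    proof (rule valuation_exE[OF v])
      fix w assume w: "Qval w" and "w (Conj (P (Var 0)) (BAll (Var 0) (R (Var 0))))"
      then have p: "w (P (Var 0))" and "w (Forall (Imp (Less (Var 0) (Var 1)) (R (Var 0))))"
        by (simp_all add: valuation_simps[OF w] BAll_def)
      then have "w (Less (num m) (Var 0)) \<longrightarrow> w (R (num m))"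
        using valuation_inst[OF w, of "Imp (Less (Var 0) (Var 1)) (R (Var 0))" "num m"]
        by (simp add: predicate_inst[OF R] valuation_simps[OF w])
      moreover have "\<not> w (R (num m))"
        using valuation_provable[OF w assms(4)] by (simp add: valuation_simps[OF w])
      ultimately obtain k where "k \<le> m" "w (Eq (Var 0) (num k))"
        using Q_trichotomy[OF w] by blast
      then have "w (P (num k))" "w (Neg (P (num k)))"
        using p predicate_leibniz[OF P w] valuation_provable[OF w assms(3)] by blast+
      then show "w (lift (Neg (Eq Zero Zero)))" by (simp add: valuation_simps[OF w])
    qed
    then show False by (simp add: valuation_simps[OF v] valuation_refl[OF v])
  qed
  then show "v (Neg (Exists (Conj (P (Var 0)) (BAll (Var 0) (R (Var 0))))))"
    by (simp add: valuation_simps[OF v])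
qed

lemma Q_decides_R_Pr:
  assumes Prf: "proof_predicate T Prf" and "consistent T" and "sentence r"
  shows "T \<turnstile> r \<Longrightarrow> robinson_Q \<turnstile> R_Pr Prf r"
    and "T \<turnstile> Neg r \<Longrightarrow> robinson_Q \<turnstile> Neg (R_Pr Prf r)"
proof -
  have "sentence (Neg r)" using \<open>sentence r\<close> by (simp add: sentence_def)
  have fv: "fv Prf \<subseteq> {0, 1}" using Prf by (simp add: proof_predicate_def)
  let ?P = "\<lambda>q s. inst2 Prf s (num (code q))"
  have P: "predicate (?P q)" for q using predicate_inst2[OF fv] .
  have proved: "\<exists>m. robinson_Q \<turnstile> ?P q (num m)" if "T \<turnstile> q" "sentence q" for q
    using Prf that by (simp add: proof_predicate_def gnum_def)
  have unproved: "robinson_Q \<turnstile> Neg (?P q (num n))" if "\<not> T \<turnstile> q" "sentence q" for q n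
    using Prf that unfolding proof_predicate_def gnum_def by blast
  have R_Pr: "R_Pr Prf r = Exists (Conj (?P r (Var 0)) (BAll (Var 0) (Neg (?P (Neg r) (Var 0)))))"
    by (simp add: R_Pr_def gnum_def)
  show "robinson_Q \<turnstile> R_Pr Prf r" if r: "T \<turnstile> r"
  proof -
    have "\<not> T \<turnstile> Neg r" using r \<open>consistent T\<close> by (auto simp: consistent_def)
    moreover obtain m where "robinson_Q \<turnstile> ?P r (num m)" using proved[OF r \<open>sentence r\<close>] by blast
    ultimately show ?thesis
      unfolding R_Pr using Q_Rosser_witness[OF P predicate_Neg[OF P]] unproved \<open>sentence (Neg r)\<close>
      by blast
  qed
  show "robinson_Q \<turnstile> Neg (R_Pr Prf r)" if nr: "T \<turnstile> Neg r"
  proof -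
    have "\<not> T \<turnstile> r" using nr \<open>consistent T\<close> by (auto simp: consistent_def)
    moreover obtain m where "robinson_Q \<turnstile> ?P (Neg r) (num m)"
      using proved[OF nr \<open>sentence (Neg r)\<close>] by blast
    then have "robinson_Q \<turnstile> Neg (Neg (?P (Neg r) (num m)))"
      by (intro provable_if_all_valuations) (auto simp: valuation_simps valuation_provable)
    ultimately show ?thesis
      unfolding R_Pr using Q_Rosser_refuted[OF P predicate_Neg[OF P]] unproved \<open>sentence r\<close>
      by blast
  qed
qed

lemma Rosserian_undecided:
  assumes "extends T robinson_Q" and "proof_predicate T Prf" and "consistent T"
    and "rosserian_sentence T Prf r"
  shows "\<not> T \<turnstile> r" and "\<not> T \<turnstile> Neg r"
proof -
  have r: "sentence r" and fix_r: "T \<turnstile> Iff r (Neg (R_Pr Prf r))"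
    using assms(4) by (auto simp: rosserian_sentence_def)
  note decides = Q_decides_R_Pr[OF assms(2,3) r]
  have con: "\<not> (T \<turnstile> p \<and> T \<turnstile> Neg p)" for p
    using assms(3) by (auto simp: consistent_def)
  show "\<not> T \<turnstile> r"
  proof
    assume tr: "T \<turnstile> r"
    then have "T \<turnstile> R_Pr Prf r" using decides(1) assms(1) by (simp add: extends_def)
    moreover have "T \<turnstile> Neg (R_Pr Prf r)"
    proof (rule provable_if_all_valuations)
      fix v assume v: "valuation T v"
      show "v (Neg (R_Pr Prf r))"
        using valuation_provable[OF v tr] valuation_provable[OF v fix_r]
        by (simp add: valuation_simps[OF v])
    qed
    ultimately show False using con by blast
  qed
  show "\<not> T \<turnstile> Neg r"
  proof
    assume nr: "T \<turnstile> Neg r"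
    then have nR: "T \<turnstile> Neg (R_Pr Prf r)" using decides(2) assms(1) by (simp add: extends_def)
    have "T \<turnstile> r"
    proof (rule provable_if_all_valuations)
      fix v assume v: "valuation T v"
      show "v r"
        using valuation_provable[OF v nR] valuation_provable[OF v fix_r]
        by (simp add: valuation_simps[OF v])
    qed
    then show False using nr con by blast
  qed
qed

theorem theorem3p8:
  fixes T :: "fm set" and Prf :: fm
  assumes "re_theory T" and "extends T robinson_Q"
    and "proof_predicate T Prf"
    and "consistent T"
  shows "(\<forall>\<rho>. rosserian_sentence T Prf \<rho> \<and> pi1 \<rho> \<longrightarrow> true_in_N \<rho>) \<and>
         (\<forall>\<rho>. rosserian_sentence T Prf \<rho> \<and> sigma1 \<rho> \<longrightarrow> \<not> true_in_N \<rho>)"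
proof (intro conjI allI impI; elim conjE)
  fix \<rho> assume \<rho>: "rosserian_sentence T Prf \<rho>" "pi1 \<rho>"
  then have "\<not> robinson_Q \<turnstile> Neg \<rho>"
    using Rosserian_undecided(2) assms by (auto simp: extends_def)
  then show "true_in_N \<rho>"
    using Q_refutes_false_pi1 \<rho> by (auto simp: rosserian_sentence_def)
next
  fix \<rho> assume \<rho>: "rosserian_sentence T Prf \<rho>" "sigma1 \<rho>"
  then have "\<not> robinson_Q \<turnstile> \<rho>"
    using Rosserian_undecided(1) assms by (auto simp: extends_def)
  then show "\<not> true_in_N \<rho>"
    using Q_sigma1_complete \<rho> by (auto simp: rosserian_sentence_def)
qed

end
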